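(* Let $\mathcal{A}$ and $\mathcal{B}$ be presentations of a transversal matroid $M$ on $E$. The sublattice $L_{\mathcal{A},\mathcal{B}}$ of $L_\mathcal{A}$ consists exactly of the sets $I\in L_\mathcal{A}$ satisfying condition $( * )$, together with all intersections of such sets, where $( * )$: $I=s_\mathcal{A}(X)$ for some $X\subseteq E$ with $|s_\mathcal{A}(X)|=r(X)=|s_\mathcal{B}(X)|$. Moreover, the sets $I$ satisfying $( * )$ correspond to the principal extensions $M+_X x$ of $M$ that are common to $T_\mathcal{A}$ and $T_\mathcal{B}$: for $X$ as in $( * )$, $M[\mathcal{A}^{s_\mathcal{A}(X)}]=M[\mathcal{B}^{s_\mathcal{B}(X)}]=M+_X x$.
   Context: Let $r=r(M)$, $[r]=\{1,\dots,r\}$, and let $r(\cdot)$ also denote the rank function of $M$. For a set system $\mathcal{A}=(A_i:i\in[r])$ on a finite set $E$, $M[\mathcal{A}]$ is the transversal matroid on $E$ whose independent sets are the partial transversals of $\mathcal{A}$; $\mathcal{A}$ is a presentation of $M[\mathcal{A}]$, with exactly $r$ sets. $s_\mathcal{A}(X)=\{i: X\cap A_i\neq\emptyset\}$. Fix $x\notin E$; for $I\subseteq[r]$, $\mathcal{A}^I$ is obtained from $\mathcal{A}$ by replacing $A_i$ by $A_i\cup\{x\}$ for each $i\in I$. Let $\sigma_\mathcal{A}(I)=I\cup\{k\in[r]-I: x\text{ is a coloop of } M[\mathcal{A}^I]\backslash A_k\}$; $L_\mathcal{A}$ is the set of $I\subseteq[r]$ with $\sigma_\mathcal{A}(I)=I$;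 $T_\mathcal{A}=\{M[\mathcal{A}^I]:I\in L_\mathcal{A}\}$; similarly for $\mathcal{B}$. $L_{\mathcal{A},\mathcal{B}}=\{I\in L_\mathcal{A}: M[\mathcal{A}^I]=M[\mathcal{B}^J]\text{ for some }J\in L_\mathcal{B}\}$. For $Y\subseteq E$, the principal extension $M+_Y x$ is the matroid on $E\cup\{x\}$ with rank function $r'(Z)=r(Z)$ and $r'(Z\cup\{x\})=r(Z)$ if $Y\subseteq \mathrm{cl}_M(Z)$, and $r(Z)+1$ otherwise, for $Z\subseteq E$. *)

theory Defs
  imports Main
begin

text \<open>
  A matroid is recorded by its ground set and its collection of independent sets. The independence
  axioms are not part of the type: every structure below is either of the form \<open>M[\<A>]\<close>
  for a set system on a finite set, or a deletion or principal extension of such a structure.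
\<close>

datatype 'a matroid = Matroid (ground: "'a set") (indep: "'a set set")

definition rank :: "'a matroid \<Rightarrow> 'a set \<Rightarrow> nat" where
  "rank M Z = Max {card I | I. I \<subseteq> Z \<and> I \<in> indep M}"

abbreviation full_rank :: "'a matroid \<Rightarrow> nat" where
  "full_rank M \<equiv> rank M (ground M)"

definition closure :: "'a matroid \<Rightarrow> 'a set \<Rightarrow> 'a set" where
  "closure M Z = {e \<in> ground M. rank M (insert e Z) = rank M Z}"

definition basis :: "'a matroid \<Rightarrow> 'a set \<Rightarrow> bool" where
  "basis M B \<longleftrightarrow> B \<in> indep M \<and> (\<forall>I \<in> indep M. B \<subseteq> I \<longrightarrow> I = B)"

definition coloop :: "'a matroid \<Rightarrow> 'a \<Rightarrow> bool" where
  "coloop M e \<longleftrightarrow> e \<in> ground M \<and> (\<forall>B. basis M B \<longrightarrow> e \<in> B)"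

definition delete :: "'a matroid \<Rightarrow> 'a set \<Rightarrow> 'a matroid" where
  "delete M D = Matroid (ground M - D) {I \<in> indep M. I \<subseteq> ground M - D}"

definition principal_ext_rank :: "'a matroid \<Rightarrow> 'a set \<Rightarrow> 'a \<Rightarrow> 'a set \<Rightarrow> nat" where
  "principal_ext_rank M Y x W =
     (if x \<in> W
      then (if Y \<subseteq> closure M (W - {x}) then rank M (W - {x}) else rank M (W - {x}) + 1)
      else rank M W)"

text \<open>
  The principal extension \<open>M +\<^sub>Y x\<close> is the matroid on \<open>E \<union> {x}\<close> with the above rank function;
  its independent sets are the sets whose rank equals their cardinality.
\<close>

definition principal_extension :: "'a matroid \<Rightarrow> 'a set \<Rightarrow> 'a \<Rightarrow> 'a matroid" where
  "principal_extension M Y x =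
     Matroid (insert x (ground M))
       {W. W \<subseteq> insert x (ground M) \<and> principal_ext_rank M Y x W = card W}"

definition partial_transversal :: "nat \<Rightarrow> (nat \<Rightarrow> 'a set) \<Rightarrow> 'a set \<Rightarrow> bool" where
  "partial_transversal r A Z \<longleftrightarrow>
     (\<exists>f. inj_on f Z \<and> (\<forall>z \<in> Z. f z \<in> {1..r} \<and> z \<in> A (f z)))"

definition transversal_matroid :: "'a set \<Rightarrow> nat \<Rightarrow> (nat \<Rightarrow> 'a set) \<Rightarrow> 'a matroid" where
  "transversal_matroid E r A = Matroid E {Z. Z \<subseteq> E \<and> partial_transversal r A Z}"

text \<open>
  A set system \<open>(A\<^sub>i : i \<in> [r])\<close> is a function on the naturals of which only the values on
  \<open>{1..r}\<close> matter; a presentation of \<open>M\<close> has exactly \<open>r = r(M)\<close> sets.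
\<close>

definition presentation :: "'a matroid \<Rightarrow> (nat \<Rightarrow> 'a set) \<Rightarrow> bool" where
  "presentation M A \<longleftrightarrow>
     (\<forall>i \<in> {1..full_rank M}. A i \<subseteq> ground M) \<and>
     M = transversal_matroid (ground M) (full_rank M) A"

definition supp :: "'a matroid \<Rightarrow> (nat \<Rightarrow> 'a set) \<Rightarrow> 'a set \<Rightarrow> nat set" where
  "supp M A X = {i \<in> {1..full_rank M}. X \<inter> A i \<noteq> {}}"

definition extend_system :: "(nat \<Rightarrow> 'a set) \<Rightarrow> 'a \<Rightarrow> nat set \<Rightarrow> nat \<Rightarrow> 'a set" where
  "extend_system A x I = (\<lambda>i. if i \<in> I then insert x (A i) else A i)"

text \<open>For a presentation \<open>\<A>\<close> of \<open>M\<close> on \<open>E\<close>, this is the matroid \<open>M[\<A>\<^sup>I]\<close> on \<open>E \<union> {x}\<close>.\<close>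

definition ext_matroid ::
  "'a matroid \<Rightarrow> (nat \<Rightarrow> 'a set) \<Rightarrow> 'a \<Rightarrow> nat set \<Rightarrow> 'a matroid" where
  "ext_matroid M A x I =
     transversal_matroid (insert x (ground M)) (full_rank M) (extend_system A x I)"

definition sigma :: "'a matroid \<Rightarrow> (nat \<Rightarrow> 'a set) \<Rightarrow> 'a \<Rightarrow> nat set \<Rightarrow> nat set" where
  "sigma M A x I =
     I \<union> {k \<in> {1..full_rank M} - I. coloop (delete (ext_matroid M A x I) (A k)) x}"

definition L_sets :: "'a matroid \<Rightarrow> (nat \<Rightarrow> 'a set) \<Rightarrow> 'a \<Rightarrow> nat set set" where
  "L_sets M A x = {I. I \<subseteq> {1..full_rank M} \<and> sigma M A x I = I}"

definition T_exts :: "'a matroid \<Rightarrow> (nat \<Rightarrow> 'a set) \<Rightarrow> 'a \<Rightarrow> 'a matroid set" where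
  "T_exts M A x = {ext_matroid M A x I | I. I \<in> L_sets M A x}"

definition L_common ::
  "'a matroid \<Rightarrow> (nat \<Rightarrow> 'a set) \<Rightarrow> (nat \<Rightarrow> 'a set) \<Rightarrow> 'a \<Rightarrow> nat set set" where
  "L_common M A B x =
     {I \<in> L_sets M A x. \<exists>J \<in> L_sets M B x. ext_matroid M A x I = ext_matroid M B x J}"

definition tight :: "'a matroid \<Rightarrow> (nat \<Rightarrow> 'a set) \<Rightarrow> (nat \<Rightarrow> 'a set) \<Rightarrow> 'a set \<Rightarrow> bool" where
  "tight M A B X \<longleftrightarrow>
     X \<subseteq> ground M \<and> card (supp M A X) = rank M X \<and> rank M X = card (supp M B X)"

text \<open>Condition \<open>(*)\<close> on an index set \<open>I\<close>.\<close>

definition star :: "'a matroid \<Rightarrow> (nat \<Rightarrow> 'a set) \<Rightarrow> (nat \<Rightarrow> 'a set) \<Rightarrow> nat set \<Rightarrow> bool" where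
  "star M A B I \<longleftrightarrow> (\<exists>X. tight M A B X \<and> I = supp M A X)"

end

theory Submission
  imports Defs "HOL.Hull"
begin

text \<open>
  Call a set \<open>X\<close> tight if \<open>|s(X)| = r(X)\<close>. By Hall's theorem, for independent \<open>Z\<close> the set
  \<open>Z \<union> {x}\<close> is dependent in \<open>M[\<A>\<^sup>I]\<close> iff \<open>I \<subseteq> s(Y)\<close> for some tight \<open>Y \<subseteq> Z\<close>. Hence \<open>\<sigma>(I)\<close> is
  the intersection of all supports of tight sets that contain \<open>I\<close>, and since tight sets are closed
  under union, \<open>L\<close> is a lattice of sets.

  If \<open>M[\<A>\<^sup>I] = M[\<B>\<^sup>J]\<close>, the minimal independent sets spanning \<open>x\<close> are tight for both
  presentations, and \<open>I\<close> is the intersection of their supports. Conversely, let \<open>X\<close> range over a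
  family of sets that are tight for both. The ranks of the systems obtained by deleting the indices
  in \<open>s(X)\<close> are those of the contraction \<open>M/X\<close>, so they agree for \<open>\<A>\<close> and \<open>\<B>\<close>; submodularity
  in the set of indices carries this agreement over to the intersection of the supports, and
  agreement of these ranks determines the extension.
\<close>

section \<open>Hall's theorem\<close>

definition hits :: "('i \<Rightarrow> 'a set) \<Rightarrow> 'i set \<Rightarrow> 'a set \<Rightarrow> 'i set" where
  "hits A C V = {i \<in> C. V \<inter> A i \<noteq> {}}"

definition matchable :: "('i \<Rightarrow> 'a set) \<Rightarrow> 'i set \<Rightarrow> 'a set \<Rightarrow> bool" where
  "matchable A C Z \<longleftrightarrow> (\<exists>f. inj_on f Z \<and> (\<forall>z \<in> Z. f z \<in> C \<and> z \<in> A (f z)))"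

definition hall_condition :: "('i \<Rightarrow> 'a set) \<Rightarrow> 'i set \<Rightarrow> 'a set \<Rightarrow> bool" where
  "hall_condition A C Z \<longleftrightarrow> (\<forall>V\<subseteq>Z. card V \<le> card (hits A C V))"

definition critical :: "('i \<Rightarrow> 'a set) \<Rightarrow> 'i set \<Rightarrow> 'a set \<Rightarrow> bool" where
  "critical A C V \<longleftrightarrow> card (hits A C V) = card V"

lemma finite_hits: "finite C \<Longrightarrow> finite (hits A C V)"
  by (simp add: hits_def)

lemma hits_mono: "V \<subseteq> W \<Longrightarrow> hits A C V \<subseteq> hits A C W"
  by (auto simp: hits_def)

lemma hits_Un: "hits A C (V \<union> W) = hits A C V \<union> hits A C W"
  by (auto simp: hits_def)

lemma hits_Int_indices: "hits A (C \<inter> D) V = hits A C V \<inter> D"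
  by (auto simp: hits_def)

lemma hits_Diff_indices: "hits A (C - D) V = hits A C V - D"
  by (auto simp: hits_def)

lemma hits_empty [simp]: "hits A C {} = {}"
  by (simp add: hits_def)

lemma card_add_le_card_add:
  assumes "finite S" "finite T" "P \<union> Q \<subseteq> S \<union> T" "P \<inter> Q \<subseteq> S \<inter> T"
  shows "card P + card Q \<le> card S + card T"
proof -
  have "finite P" "finite Q"
    using assms by (auto intro: finite_subset)
  then have "card P + card Q = card (P \<union> Q) + card (P \<inter> Q)"
    by (rule card_Un_Int)
  also have "\<dots> \<le> card (S \<union> T) + card (S \<inter> T)"
    using assms by (intro add_mono card_mono) auto
  also have "\<dots> = card S + card T"
    using card_Un_Int[OF assms(1,2)] by simp
  finally show ?thesis .
qed

lemma card_hits_bisubmodular: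
  assumes "finite C" "finite D"
  shows "card (hits A (C \<union> D) (V \<inter> W)) + card (hits A (C \<inter> D) (V \<union> W))
    \<le> card (hits A C V) + card (hits A D W)"
  using assms by (intro card_add_le_card_add) (auto simp: hits_def)

lemma matchable_subset: "matchable A C Z \<Longrightarrow> Y \<subseteq> Z \<Longrightarrow> matchable A C Y"
  unfolding matchable_def by (blast intro: inj_on_subset)

lemma matchable_mono_indices: "matchable A C Z \<Longrightarrow> C \<subseteq> D \<Longrightarrow> matchable A D Z"
  unfolding matchable_def by blast

lemma matchable_insert_iff:
  assumes "z \<notin> Z"
  shows "matchable A C (insert z Z) \<longleftrightarrow> (\<exists>i\<in>C. z \<in> A i \<and> matchable A (C - {i}) Z)"
proof
  assume "matchable A C (insert z Z)"
  then obtain f where "inj_on f (insert z Z)" "\<forall>y\<in>insert z Z. f y \<in> C \<and> y \<in> A (f y)"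
    by (auto simp: matchable_def)
  then have "f z \<in> C" "z \<in> A (f z)" "inj_on f Z" "\<forall>y\<in>Z. f y \<in> C - {f z} \<and> y \<in> A (f y)"
    using assms unfolding inj_on_insert by auto (metis image_eqI)
  then show "\<exists>i\<in>C. z \<in> A i \<and> matchable A (C - {i}) Z"
    unfolding matchable_def by blast
next
  assume "\<exists>i\<in>C. z \<in> A i \<and> matchable A (C - {i}) Z"
  then obtain i f where f: "i \<in> C" "z \<in> A i" "inj_on f Z" "\<forall>y\<in>Z. f y \<in> C - {i} \<and> y \<in> A (f y)"
    by (auto simp: matchable_def)
  moreover from f have "inj_on (f(z := i)) (insert z Z)"
    using assms by (auto simp: inj_on_def)
  ultimately show "matchable A C (insert z Z)"
    using assms unfolding matchable_def by (intro exI[of _ "f(z := i)"]) auto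
qed

lemma matchable_cong:
  assumes "\<And>z i. z \<in> Z \<Longrightarrow> i \<in> C \<Longrightarrow> z \<in> A i \<longleftrightarrow> z \<in> B i"
  shows "matchable A C Z \<longleftrightarrow> matchable B C Z"
  unfolding matchable_def using assms by (intro ex_cong1 conj_cong ball_cong refl) blast

lemma hall_condition_subset: "hall_condition A C Z \<Longrightarrow> Y \<subseteq> Z \<Longrightarrow> hall_condition A C Y"
  by (auto simp: hall_condition_def)

lemma hall_condition_if_matchable:
  assumes "finite C" "matchable A C Z"
  shows "hall_condition A C Z"
  unfolding hall_condition_def
proof (intro allI impI)
  fix V assume "V \<subseteq> Z"
  then obtain f where f: "inj_on f V" "\<forall>z\<in>V. f z \<in> C \<and> z \<in> A (f z)"
    using matchable_subset[OF assms(2) \<open>V \<subseteq> Z\<close>] by (auto simp: matchable_def)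
  then have "f ` V \<subseteq> hits A C V" by (auto simp: hits_def)
  then show "card V \<le> card (hits A C V)"
    by (rule card_inj_on_le[OF f(1) _ finite_hits[OF assms(1)]])
qed

lemma not_hall_condition_Diff_iff:
  assumes "finite C" "hall_condition A C Z"
  shows "\<not> hall_condition A (C - {i}) Z
    \<longleftrightarrow> (\<exists>V\<subseteq>Z. critical A C V \<and> i \<in> hits A C V)"
proof -
  have "card V \<le> card (hits A (C - {i}) V)
      \<longleftrightarrow> \<not> (critical A C V \<and> i \<in> hits A C V)" if "V \<subseteq> Z" for V
  proof (cases "i \<in> hits A C V")
    case True
    then have "card (hits A C V) = Suc (card (hits A (C - {i}) V))"
      using card.remove[OF finite_hits[OF assms(1)] True] by (simp add: hits_Diff_indices)
    then show ?thesis
      using assms(2) that True by (auto simp: hall_condition_def critical_def)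
  next
    case False
    then show ?thesis
      using assms(2) that by (simp add: hall_condition_def hits_Diff_indices)
  qed
  then show ?thesis unfolding hall_condition_def by blast
qed

lemma critical_Un:
  assumes "finite C" "finite Z" "hall_condition A C Z" "V \<subseteq> Z" "W \<subseteq> Z"
    and "critical A C V" "critical A C W"
  shows "critical A C (V \<union> W)"
proof -
  have "finite V" "finite W"
    using assms(2,4,5) finite_subset by auto
  then have "card V + card W = card (V \<union> W) + card (V \<inter> W)"
    by (rule card_Un_Int)
  moreover have "card (hits A C (V \<inter> W)) + card (hits A C (V \<union> W)) \<le> card V + card W"
    using card_hits_bisubmodular[OF assms(1,1), of A V W] assms(6,7)
    by (simp add: critical_def)
  moreover have "card (V \<union> W) \<le> card (hits A C (V \<union> W))" "card (V \<inter> W) \<le> card (hits A C (V \<inter> W))"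
    using assms(3-5) le_infI1[of V Z W] by (simp_all add: hall_condition_def)
  ultimately show ?thesis unfolding critical_def by linarith
qed

lemma largest_critical_subset:
  assumes "finite C" "finite Z" "hall_condition A C Z"
  obtains Y where "Y \<subseteq> Z" "critical A C Y"
    "hits A C Y = {i. \<not> hall_condition A (C - {i}) Z}"
proof -
  let ?F = "{Y. Y \<subseteq> Z \<and> critical A C Y}"
  have "finite ?F" "{} \<in> ?F" using assms(2) by (auto simp: critical_def)
  from finite_has_maximal2[OF this]
  obtain Y where Y: "Y \<in> ?F" "\<forall>V\<in>?F. Y \<subseteq> V \<longrightarrow> Y = V"
    by (elim bexE conjE)
  have largest: "V \<subseteq> Y" if "V \<subseteq> Z" "critical A C V" for V
    using bspec[OF Y(2), of "Y \<union> V"] critical_Un[OF assms, of Y V] Y(1) that by auto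
  have "i \<in> hits A C Y \<longleftrightarrow> \<not> hall_condition A (C - {i}) Z" for i
    unfolding not_hall_condition_Diff_iff[OF assms(1,3)]
    using Y(1) hits_mono[OF largest, of _ A C] by auto
  then have "hits A C Y = {i. \<not> hall_condition A (C - {i}) Z}"
    by blast
  then show thesis using that Y(1) by blast
qed

text \<open>
  Matching \<open>z\<close> to an index \<open>i\<close> fails only if \<open>i\<close> is hit by the largest critical subset \<open>Y\<close> of the
  remaining elements; if this happens for all candidates \<open>i\<close>, then \<open>Y \<union> {z}\<close> violates Hall's
  condition.
\<close>

lemma matchable_if_hall_condition:
  assumes "finite Z" "finite C" "hall_condition A C Z"
  shows "matchable A C Z"
  using assms
proof (induction Z arbitrary: C)
  case empty
  show ?case by (simp add: matchable_def)
next
  case (insert z Z)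
  have hall_Z: "hall_condition A C Z"
    using insert.prems(2) by (rule hall_condition_subset) auto
  obtain Y where Y: "Y \<subseteq> Z" "critical A C Y"
      "hits A C Y = {i. \<not> hall_condition A (C - {i}) Z}"
    using largest_critical_subset[OF insert.prems(1) insert.hyps(1) hall_Z] .
  have "finite Y" "z \<notin> Y"
    using Y(1) insert.hyps finite_subset by auto
  then have "card (hits A C Y) < card (insert z Y)"
    using Y(2) by (simp add: critical_def)
  also have "\<dots> \<le> card (hits A C (insert z Y))"
    using insert.prems(2) insert_mono[OF Y(1)] by (simp add: hall_condition_def)
  finally have "hits A C Y \<noteq> hits A C Y \<union> hits A C {z}"
    using hits_Un[of A C Y "{z}"] by auto
  then obtain i where i: "i \<in> C" "z \<in> A i" "hall_condition A (C - {i}) Z"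
    using Y(3) by (auto simp: hits_def)
  then have "matchable A (C - {i}) Z"
    using insert.IH insert.prems(1) by blast
  then show ?case
    using i matchable_insert_iff[OF insert.hyps(2)] by blast
qed

theorem matchable_iff_hall_condition:
  assumes "finite Z" "finite C"
  shows "matchable A C Z \<longleftrightarrow> hall_condition A C Z"
  using hall_condition_if_matchable[OF assms(2)] matchable_if_hall_condition[OF assms] by blast

section \<open>The rank function of a set system\<close>

text \<open>
  By the deficiency form of Hall's theorem this is the maximal size of a matching between the
  elements of \<open>Y\<close> and the indices in \<open>C\<close>. Taking the min-formula as the definition reduces all
  submodularity arguments to counting.
\<close>

definition matching_rank :: "('i \<Rightarrow> 'a set) \<Rightarrow> 'i set \<Rightarrow> 'a set \<Rightarrow> nat" where
  "matching_rank A C Y = Min ((\<lambda>V. card (hits A C V) + card (Y - V)) ` Pow Y)"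

lemma matching_rank_le:
  assumes "finite Y" "V \<subseteq> Y"
  shows "matching_rank A C Y \<le> card (hits A C V) + card (Y - V)"
  unfolding matching_rank_def using assms by (intro Min_le) auto

lemma matching_rank_attained:
  assumes "finite Y"
  obtains V where "V \<subseteq> Y" "matching_rank A C Y = card (hits A C V) + card (Y - V)"
proof -
  have "matching_rank A C Y \<in> (\<lambda>V. card (hits A C V) + card (Y - V)) ` Pow Y"
    unfolding matching_rank_def using assms by (intro Min_in) auto
  then show thesis using that by auto
qed

lemma matching_rank_le_card: "finite Y \<Longrightarrow> matching_rank A C Y \<le> card Y"
  using matching_rank_le[of Y "{}" A C] by simp

lemma matching_rank_le_card_hits: "finite Y \<Longrightarrow> matching_rank A C Y \<le> card (hits A C Y)"
  using matching_rank_le[of Y Y A C] by simp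

lemma matching_rank_empty [simp]: "matching_rank A C {} = 0"
  using matching_rank_le_card[of "{}" A C] by simp

lemma matching_rank_no_indices [simp]: "finite Y \<Longrightarrow> matching_rank A {} Y = 0"
  using matching_rank_le_card_hits[of Y A "{}"] by (simp add: hits_def)

lemma matching_rank_bisubmodular:
  assumes "finite C" "finite D" "finite Y" "finite Z"
  shows "matching_rank A (C \<union> D) (Y \<inter> Z) + matching_rank A (C \<inter> D) (Y \<union> Z)
    \<le> matching_rank A C Y + matching_rank A D Z"
proof -
  obtain V where V: "V \<subseteq> Y" "matching_rank A C Y = card (hits A C V) + card (Y - V)"
    using matching_rank_attained[OF assms(3)] .
  obtain W where W: "W \<subseteq> Z" "matching_rank A D Z = card (hits A D W) + card (Z - W)"
    using matching_rank_attained[OF assms(4)] .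
  have "card (Y \<inter> Z - V \<inter> W) + card (Y \<union> Z - (V \<union> W)) \<le> card (Y - V) + card (Z - W)"
    using assms(3,4) by (intro card_add_le_card_add) auto
  moreover have "matching_rank A (C \<union> D) (Y \<inter> Z)
      \<le> card (hits A (C \<union> D) (V \<inter> W)) + card (Y \<inter> Z - V \<inter> W)"
    using assms V W by (intro matching_rank_le) auto
  moreover have "matching_rank A (C \<inter> D) (Y \<union> Z)
      \<le> card (hits A (C \<inter> D) (V \<union> W)) + card (Y \<union> Z - (V \<union> W))"
    using assms V W by (intro matching_rank_le) auto
  ultimately show ?thesis
    using V W card_hits_bisubmodular[OF assms(1,2), of A V W] by linarith
qed

lemma matching_rank_mono:
  assumes "finite C" "finite Z" "Y \<subseteq> Z"
  shows "matching_rank A C Y \<le> matching_rank A C Z"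
  using matching_rank_bisubmodular[of C "{}" Z Y A] assms finite_subset[OF assms(3,2)]
  by (simp add: Int_absorb1)

lemma matching_rank_Un_le:
  assumes "finite C" "finite Y" "finite Z"
  shows "matching_rank A C (Y \<union> Z) \<le> matching_rank A C Y + matching_rank A C Z"
  using matching_rank_bisubmodular[OF assms(1,1,2,3), of A] by simp

lemma matching_rank_Un_indices_le:
  assumes "finite C" "finite D" "finite Y"
  shows "matching_rank A (C \<union> D) Y \<le> matching_rank A C Y + matching_rank A D Y"
  using matching_rank_bisubmodular[OF assms(1,2,3,3), of A] by simp

lemma matching_rank_le_add_card_Diff:
  assumes "finite C" "finite Y" "V \<subseteq> Y"
  shows "matching_rank A C Y \<le> matching_rank A C V + card (Y - V)"
proof -
  have "V \<union> (Y - V) = Y" using assms(3) by blast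
  then have "matching_rank A C Y \<le> matching_rank A C V + matching_rank A C (Y - V)"
    using matching_rank_Un_le[OF assms(1) finite_subset[OF assms(3,2)], of "Y - V" A] assms(2)
    by simp
  also have "\<dots> \<le> matching_rank A C V + card (Y - V)"
    using matching_rank_le_card assms(2) by (intro add_left_mono) blast
  finally show ?thesis .
qed

lemma matching_rank_Un_eq:
  assumes "finite X" "finite Y" "finite C"
    and "\<And>e. e \<in> X \<Longrightarrow> matching_rank A C (insert e Y) = matching_rank A C Y"
  shows "matching_rank A C (Y \<union> X) = matching_rank A C Y"
  using assms(1,4)
proof (induction X)
  case (insert e X)
  have "matching_rank A C ((Y \<union> X) \<inter> insert e Y) + matching_rank A C (Y \<union> insert e X)
      \<le> matching_rank A C (Y \<union> X) + matching_rank A C (insert e Y)"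
    using matching_rank_bisubmodular[of C C "Y \<union> X" "insert e Y" A] assms(2,3) insert.hyps(1)
    by (simp add: ac_simps)
  moreover have "matching_rank A C Y \<le> matching_rank A C ((Y \<union> X) \<inter> insert e Y)"
    "matching_rank A C Y \<le> matching_rank A C (Y \<union> insert e X)"
    using assms(2,3) insert.hyps(1) by (auto intro: matching_rank_mono)
  ultimately show ?case using insert by simp
qed simp

lemma card_subset_add_card_Diff: "finite Z \<Longrightarrow> V \<subseteq> Z \<Longrightarrow> card V + card (Z - V) = card Z"
  using card_Int_Diff[of Z V] by (simp add: Int_absorb1)

lemma matchable_iff_matching_rank:
  assumes "finite Z" "finite C"
  shows "matchable A C Z \<longleftrightarrow> matching_rank A C Z = card Z"
proof -
  have "card V \<le> card (hits A C V) \<longleftrightarrow> card Z \<le> card (hits A C V) + card (Z - V)" if "V \<subseteq> Z" for V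
    using card_subset_add_card_Diff[OF assms(1) that] by linarith
  then have "hall_condition A C Z \<longleftrightarrow> card Z \<le> matching_rank A C Z"
    unfolding hall_condition_def matching_rank_def using assms(1) by (subst Min_ge_iff) auto
  then show ?thesis
    using matchable_iff_hall_condition[OF assms, of A] matching_rank_le_card[OF assms(1), of A C]
    by linarith
qed

lemma matching_rank_basis:
  assumes "finite Y" "finite C"
  obtains W where "W \<subseteq> Y" "matchable A C W" "card W = matching_rank A C Y"
proof -
  let ?F = "{W. W \<subseteq> Y \<and> matchable A C W}"
  have "finite ?F" "{} \<in> ?F" using assms by (auto simp: matchable_def)
  from finite_has_maximal2[OF this]
  obtain W where W: "W \<in> ?F" and max: "\<forall>V\<in>?F. W \<subseteq> V \<longrightarrow> W = V"
    by (elim bexE conjE)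
  have finW: "finite W" using W(1) assms(1) finite_subset by blast
  have rank_W: "matching_rank A C W = card W"
    using W matchable_iff_matching_rank[OF finW assms(2)] by blast
  have "matching_rank A C (insert e W) = matching_rank A C W" if "e \<in> Y" for e
  proof (cases "e \<in> W")
    case False
    then have "\<not> matchable A C (insert e W)"
      using bspec[OF max, of "insert e W"] W that by auto
    then have "matching_rank A C (insert e W) \<noteq> Suc (card W)"
      using matchable_iff_matching_rank[of "insert e W" C A] finW assms(2) False by simp
    moreover have "matching_rank A C (insert e W) \<le> Suc (card W)"
      using matching_rank_le_card[of "insert e W" A C] finW False by simp
    moreover have "matching_rank A C W \<le> matching_rank A C (insert e W)"
      using finW assms(2) by (intro matching_rank_mono) auto
    ultimately show ?thesis using rank_W by linarith
  qed (simp add: insert_absorb)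
  then have "matching_rank A C (W \<union> Y) = matching_rank A C W"
    using matching_rank_Un_eq[OF assms(1) finW assms(2)] by blast
  moreover have "W \<union> Y = Y" using W by blast
  ultimately show thesis using that[of W] W rank_W by simp
qed

theorem Max_card_matchable:
  assumes "finite Y" "finite C"
  shows "Max {card Z | Z. Z \<subseteq> Y \<and> matchable A C Z} = matching_rank A C Y"
proof (rule Max_eqI)
  have "{card Z | Z. Z \<subseteq> Y \<and> matchable A C Z} \<subseteq> card ` Pow Y" by auto
  then show "finite {card Z | Z. Z \<subseteq> Y \<and> matchable A C Z}"
    using assms(1) by (meson finite_Pow_iff finite_imageI finite_subset)
next
  fix n assume "n \<in> {card Z | Z. Z \<subseteq> Y \<and> matchable A C Z}"
  then obtain Z where Z: "n = card Z" "Z \<subseteq> Y" "matchable A C Z" by blast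
  then have "n = matching_rank A C Z"
    using matchable_iff_matching_rank[OF finite_subset[OF Z(2) assms(1)] assms(2)] by simp
  also have "\<dots> \<le> matching_rank A C Y"
    using assms Z(2) by (intro matching_rank_mono)
  finally show "n \<le> matching_rank A C Y" .
next
  obtain W where W: "W \<subseteq> Y" "matchable A C W" "card W = matching_rank A C Y"
    using matching_rank_basis[OF assms] .
  show "matching_rank A C Y \<in> {card Z | Z. Z \<subseteq> Y \<and> matchable A C Z}"
    unfolding W(3)[symmetric] using W(1,2) by blast
qed

lemma critical_cover_iff_matching_rank:
  assumes "finite Z" "finite C" "I \<subseteq> C" "hall_condition A C Z"
  shows "(\<exists>Y\<subseteq>Z. critical A C Y \<and> I \<subseteq> hits A C Y)
    \<longleftrightarrow> matching_rank A (C - I) Z + card I \<le> card Z"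
proof -
  have finI: "finite I" using assms(2,3) finite_subset by blast
  have card_hits: "card (hits A C V) = card (hits A C V \<inter> I) + card (hits A (C - I) V)" for V
    using card_Int_Diff[OF finite_hits[OF assms(2)], of A V I] by (simp add: hits_Diff_indices)
  show ?thesis
  proof
    assume "\<exists>Y\<subseteq>Z. critical A C Y \<and> I \<subseteq> hits A C Y"
    then obtain Y where Y: "Y \<subseteq> Z" "critical A C Y" "I \<subseteq> hits A C Y" by blast
    then have "card (hits A (C - I) Y) + card I = card Y"
      using card_hits[of Y] by (simp add: critical_def Int_absorb1)
    then show "matching_rank A (C - I) Z + card I \<le> card Z"
      using matching_rank_le[OF assms(1) Y(1), of A "C - I"]
        card_subset_add_card_Diff[OF assms(1) Y(1)] by linarith
  next
    assume rank_le: "matching_rank A (C - I) Z + card I \<le> card Z"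
    obtain Y where Y: "Y \<subseteq> Z" "matching_rank A (C - I) Z = card (hits A (C - I) Y) + card (Z - Y)"
      using matching_rank_attained[OF assms(1)] .
    have "card (hits A (C - I) Y) + card I \<le> card Y"
      using rank_le Y(2) card_subset_add_card_Diff[OF assms(1) Y(1)] by linarith
    moreover have "card Y \<le> card (hits A C Y)"
      using assms(4) Y(1) by (simp add: hall_condition_def)
    moreover have "card (hits A C Y \<inter> I) \<le> card I"
      using finI by (simp add: card_mono)
    ultimately have "critical A C Y" "card (hits A C Y \<inter> I) = card I"
      using card_hits[of Y] unfolding critical_def by linarith+
    then show "\<exists>Y\<subseteq>Z. critical A C Y \<and> I \<subseteq> hits A C Y"
      using Y(1) card_subset_eq[OF finI, of "hits A C Y \<inter> I"] by (intro exI[of _ Y]) auto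
  qed
qed

lemma unavoidable_iff_critical_cover:
  assumes "finite Z" "finite C" "matchable A C Z"
  shows "(\<forall>i\<in>I. \<not> matchable A (C - {i}) Z)
    \<longleftrightarrow> (\<exists>Y\<subseteq>Z. critical A C Y \<and> I \<subseteq> hits A C Y)"
proof -
  have hall: "hall_condition A C Z"
    using assms(2,3) by (rule hall_condition_if_matchable)
  obtain Y where Y: "Y \<subseteq> Z" "critical A C Y"
      "hits A C Y = {i. \<not> hall_condition A (C - {i}) Z}"
    using largest_critical_subset[OF assms(2,1) hall] .
  have "(\<forall>i\<in>I. \<not> matchable A (C - {i}) Z) \<longleftrightarrow> I \<subseteq> {i. \<not> hall_condition A (C - {i}) Z}"
    using matchable_iff_hall_condition[OF assms(1), of "C - {_}" A] assms(2) by auto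
  also have "\<dots> \<longleftrightarrow> (\<exists>Y\<subseteq>Z. critical A C Y \<and> I \<subseteq> hits A C Y)"
    using Y not_hall_condition_Diff_iff[OF assms(2) hall] by blast
  finally show ?thesis .
qed

section \<open>Saturating sets\<close>

definition saturating :: "('i \<Rightarrow> 'a set) \<Rightarrow> 'i set \<Rightarrow> 'a set \<Rightarrow> bool" where
  "saturating A C X \<longleftrightarrow> matching_rank A C X = card (hits A C X)"

lemma saturating_subset_indices:
  assumes "finite X" "finite C" "D \<subseteq> C" "saturating A C X"
  shows "saturating A D X"
proof -
  have eq: "D \<union> (C - D) = C" using assms(3) by blast
  have "hits A D X = hits A C X \<inter> D"
    using assms(3) by (auto simp: hits_def)
  then have "card (hits A D X) + card (hits A (C - D) X) = card (hits A C X)"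
    using card_Int_Diff[OF finite_hits[OF assms(2)], of A X D] by (simp add: hits_Diff_indices)
  also have "\<dots> \<le> matching_rank A D X + matching_rank A (C - D) X"
    using matching_rank_Un_indices_le[of D "C - D" X A] assms eq finite_subset[OF assms(3,2)]
    by (simp add: saturating_def)
  also have "\<dots> \<le> matching_rank A D X + card (hits A (C - D) X)"
    using assms(1) by (intro add_left_mono matching_rank_le_card_hits)
  finally show ?thesis
    using matching_rank_le_card_hits[OF assms(1), of A D] by (simp add: saturating_def)
qed

lemma matching_rank_contract:
  assumes "finite X" "finite Y" "finite C" "saturating A C X"
  shows "matching_rank A C (Y \<union> X) = matching_rank A (C - hits A C X) Y + card (hits A C X)"
proof (rule antisym)
  let ?H = "hits A C X"
  have zero: "matching_rank A (C - ?H) X = 0"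
    using matching_rank_le_card_hits[OF assms(1), of A "C - ?H"] by (simp add: hits_Diff_indices)
  have finH: "finite ?H" and C: "(C - ?H) \<union> ?H = C"
    using assms(3) by (auto simp: hits_def)
  have "matching_rank A C (Y \<union> X) \<le> matching_rank A (C - ?H) (Y \<union> X) + matching_rank A ?H (Y \<union> X)"
    using matching_rank_Un_indices_le[of "C - ?H" ?H "Y \<union> X" A] assms finH C by simp
  also have "matching_rank A (C - ?H) (Y \<union> X) \<le> matching_rank A (C - ?H) Y"
    using matching_rank_Un_le[of "C - ?H" Y X A] assms zero by simp
  also have "matching_rank A ?H (Y \<union> X) \<le> card (hits A ?H (Y \<union> X))"
    using assms by (intro matching_rank_le_card_hits) simp
  also have "\<dots> \<le> card ?H"
    using finH by (intro card_mono) (auto simp: hits_def)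
  finally show "matching_rank A C (Y \<union> X) \<le> matching_rank A (C - ?H) Y + card ?H" by simp
  have "matching_rank A (C - ?H) Y \<le> matching_rank A (C - ?H) (Y \<union> X)"
    using assms by (intro matching_rank_mono) auto
  moreover have "matching_rank A C X + matching_rank A (C - ?H) (Y \<union> X)
      \<le> matching_rank A C (Y \<union> X) + matching_rank A (C - ?H) X"
    using matching_rank_bisubmodular[of C "C - ?H" "Y \<union> X" X A] assms
    by (simp add: Un_absorb2 Int_absorb1 Int_absorb2 Un_assoc)
  ultimately show "matching_rank A (C - ?H) Y + card ?H \<le> matching_rank A C (Y \<union> X)"
    using assms(4) zero by (simp add: saturating_def)
qed

lemma saturating_Un:
  assumes "finite X" "finite Y" "finite C" "saturating A C X" "saturating A C Y"
  shows "saturating A C (Y \<union> X)"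
proof -
  let ?H = "hits A C X"
  have "matching_rank A C (Y \<union> X) = matching_rank A (C - ?H) Y + card ?H"
    using assms(1-4) by (rule matching_rank_contract)
  also have "matching_rank A (C - ?H) Y = card (hits A C Y - ?H)"
    using saturating_subset_indices[OF assms(2,3) _ assms(5), of "C - ?H"]
    by (simp add: saturating_def hits_Diff_indices)
  also have "card (hits A C Y - ?H) + card ?H = card (hits A C (Y \<union> X))"
    using card_Un_disjoint[of "hits A C Y - ?H" ?H] finite_hits[OF assms(3), of A]
    by (simp add: hits_Un Diff_Int_distrib2)
  finally show ?thesis by (simp add: saturating_def)
qed

lemma hits_subset_if_matching_rank_Un_eq:
  assumes "finite X" "finite Y" "finite C" "saturating A C X"
    and "matching_rank A C (Y \<union> X) = matching_rank A C X"
  shows "hits A C Y \<subseteq> hits A C X"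
proof -
  let ?D = "C - hits A C X"
  have "matching_rank A ?D Y = 0"
    using matching_rank_contract[OF assms(1-4)] assms(4,5) by (simp add: saturating_def)
  moreover obtain V where V: "V \<subseteq> Y" "matching_rank A ?D Y = card (hits A ?D V) + card (Y - V)"
    using matching_rank_attained[OF assms(2)] .
  ultimately have "hits A ?D V = {}" "Y - V = {}"
    using finite_hits[of ?D A V] assms(2,3) by (simp_all add: card_eq_0_iff)
  then show ?thesis using V(1) by (auto simp: hits_def)
qed

section \<open>Set systems with the same rank function\<close>

text \<open>The subsystems \<open>(A\<^sub>i : i \<in> C)\<close> and \<open>(B\<^sub>j : j \<in> D)\<close> present the same matroid on \<open>E\<close>.\<close>

definition equirank ::
  "'a set \<Rightarrow> ('i \<Rightarrow> 'a set) \<Rightarrow> 'i set \<Rightarrow> ('j \<Rightarrow> 'a set) \<Rightarrow> 'j set \<Rightarrow> bool" where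
  "equirank E A C B D \<longleftrightarrow> (\<forall>Y\<subseteq>E. matching_rank A C Y = matching_rank B D Y)"

lemma equirank_sym: "equirank E A C B D \<Longrightarrow> equirank E B D A C"
  by (simp add: equirank_def)

lemma equirank_contract:
  assumes "finite E" "finite C" "finite D" "X \<subseteq> E"
    and "equirank E A C B D" "saturating A C X" "saturating B D X"
  shows "equirank E A (C - hits A C X) B (D - hits B D X)"
  unfolding equirank_def
proof (intro allI impI)
  fix Y assume "Y \<subseteq> E"
  then have fin: "finite X" "finite Y" using assms(1,4) finite_subset by auto
  have "matching_rank A C (Y \<union> X) = matching_rank B D (Y \<union> X)"
    "matching_rank A C X = matching_rank B D X"
    using assms(4,5) \<open>Y \<subseteq> E\<close> by (auto simp: equirank_def)
  then show "matching_rank A (C - hits A C X) Y = matching_rank B (D - hits B D X) Y"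
    using matching_rank_contract[OF fin assms(2,6)] matching_rank_contract[OF fin assms(3,7)]
      assms(6,7) by (simp add: saturating_def)
qed

text \<open>
  On a set \<open>V\<close> attaining the min-formula for \<open>C1 \<union> C2\<close> the \<open>A\<close>-ranks are cardinalities, hence
  modular in the index set, while the \<open>B\<close>-ranks are submodular.
\<close>

lemma matching_rank_Un_indices_le_if_equirank:
  assumes fin: "finite E" "finite C1" "finite C2" "finite D1" "finite D2" and "Y \<subseteq> E"
    and eq: "equirank E A C1 B D1" "equirank E A C2 B D2" "equirank E A (C1 \<inter> C2) B (D1 \<inter> D2)"
  shows "matching_rank B (D1 \<union> D2) Y \<le> matching_rank A (C1 \<union> C2) Y"
proof -
  let ?C = "C1 \<union> C2" and ?D = "D1 \<union> D2"
  have finY: "finite Y" and finC: "finite ?C" and finD: "finite ?D"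
    using fin \<open>Y \<subseteq> E\<close> finite_subset by auto
  obtain V where V: "V \<subseteq> Y" "matching_rank A ?C Y = card (hits A ?C V) + card (Y - V)"
    using matching_rank_attained[OF finY] .
  have finV: "finite V" and "V \<subseteq> E" using V(1) finY \<open>Y \<subseteq> E\<close> finite_subset by auto
  have "saturating A ?C V"
    using matching_rank_le_add_card_Diff[OF finC finY V(1), of A] V(2)
      matching_rank_le_card_hits[OF finV, of A ?C] by (simp add: saturating_def)
  then have rank_A: "matching_rank A K V = card (hits A K V)" if "K \<subseteq> ?C" for K
    using saturating_subset_indices[OF finV finC that] by (simp add: saturating_def)
  have "matching_rank B ?D V + matching_rank B (D1 \<inter> D2) V
      \<le> matching_rank B D1 V + matching_rank B D2 V"
    using matching_rank_bisubmodular[OF fin(4,5) finV finV] by simp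
  also have "\<dots> = card (hits A C1 V) + card (hits A C2 V)"
    using eq(1,2) \<open>V \<subseteq> E\<close> rank_A[of C1] rank_A[of C2] by (simp add: equirank_def)
  also have "\<dots> \<le> card (hits A ?C V) + card (hits A (C1 \<inter> C2) V)"
    using fin by (intro card_add_le_card_add) (auto simp: hits_def)
  also have "card (hits A (C1 \<inter> C2) V) = matching_rank B (D1 \<inter> D2) V"
    using eq(3) \<open>V \<subseteq> E\<close> rank_A[of "C1 \<inter> C2"] by (simp add: equirank_def le_infI1)
  finally have "matching_rank B ?D V \<le> card (hits A ?C V)" by simp
  then show ?thesis
    using matching_rank_le_add_card_Diff[OF finD finY V(1), of B] V(2) by linarith
qed

lemma equirank_Un:
  assumes "finite E" "finite C1" "finite C2" "finite D1" "finite D2"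
    and "equirank E A C1 B D1" "equirank E A C2 B D2" "equirank E A (C1 \<inter> C2) B (D1 \<inter> D2)"
  shows "equirank E A (C1 \<union> C2) B (D1 \<union> D2)"
  unfolding equirank_def
proof (intro allI impI antisym)
  fix Y assume "Y \<subseteq> E"
  show "matching_rank B (D1 \<union> D2) Y \<le> matching_rank A (C1 \<union> C2) Y"
    using assms \<open>Y \<subseteq> E\<close> by (intro matching_rank_Un_indices_le_if_equirank)
  show "matching_rank A (C1 \<union> C2) Y \<le> matching_rank B (D1 \<union> D2) Y"
    using assms(1-5) \<open>Y \<subseteq> E\<close> assms(6-8)[THEN equirank_sym]
    by (intro matching_rank_Un_indices_le_if_equirank)
qed

lemma equirank_Diff_INT_hits:
  assumes fin: "finite E" "finite C" "finite D" and eq: "equirank E A C B D"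
    and "finite \<X>" "\<X> \<noteq> {}" "\<And>X. X \<in> \<X> \<Longrightarrow> X \<subseteq> E \<and> saturating A C X \<and> saturating B D X"
  shows "equirank E A (C - (\<Inter>X\<in>\<X>. hits A C X)) B (D - (\<Inter>X\<in>\<X>. hits B D X))"
  using assms(5-)
proof (induction \<X> rule: finite_ne_induct)
  case (singleton X)
  then show ?case using equirank_contract[OF fin _ eq] by simp
next
  case (insert X \<X>)
  let ?C = "C - (\<Inter>X\<in>\<X>. hits A C X)" and ?D = "D - (\<Inter>X\<in>\<X>. hits B D X)"
  have X: "X \<subseteq> E" "saturating A C X" "saturating B D X"
    using insert.prems by simp_all
  have finX: "finite X"
    using X(1) fin(1) by (rule finite_subset)
  have eq_\<X>: "equirank E A ?C B ?D" using insert by simp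
  moreover have eq_X: "equirank E A (C - hits A C X) B (D - hits B D X)"
    using equirank_contract[OF fin X(1) eq X(2,3)] .
  moreover have "equirank E A (?C - hits A ?C X) B (?D - hits B ?D X)"
  proof (rule equirank_contract[OF fin(1) _ _ X(1) eq_\<X>])
    show "saturating A ?C X" "saturating B ?D X"
      using saturating_subset_indices[OF finX fin(2) _ X(2)]
        saturating_subset_indices[OF finX fin(3) _ X(3)] by auto
  qed (use fin in simp_all)
  moreover have "?C - hits A ?C X = ?C \<inter> (C - hits A C X)"
    "?D - hits B ?D X = ?D \<inter> (D - hits B D X)"
    by (auto simp: hits_def)
  ultimately have "equirank E A (?C \<union> (C - hits A C X)) B (?D \<union> (D - hits B D X))"
    using fin by (intro equirank_Un) simp_all
  moreover have "?C \<union> (C - hits A C X) = C - (\<Inter>X\<in>insert X \<X>. hits A C X)"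
    "?D \<union> (D - hits B D X) = D - (\<Inter>X\<in>insert X \<X>. hits B D X)"
    by auto
  ultimately show ?case by simp
qed

section \<open>Fixed points of hull operators\<close>

lemma hull_Inter_fixed:
  assumes "\<And>s. s \<in> F \<Longrightarrow> S hull s = s"
  shows "S hull \<Inter>F = \<Inter>F"
proof (rule antisym)
  show "S hull \<Inter>F \<subseteq> \<Inter>F"
  proof (rule Inter_greatest)
    fix s assume "s \<in> F"
    then have "S hull \<Inter>F \<subseteq> S hull s" by (intro hull_mono Inter_lower)
    then show "S hull \<Inter>F \<subseteq> s" using assms[OF \<open>s \<in> F\<close>] by simp
  qed
qed (rule hull_subset)

lemma hull_Un_fixed:
  assumes "\<And>u v. S u \<Longrightarrow> S v \<Longrightarrow> S (u \<union> v)" "S hull s = s" "S hull t = t"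
  shows "S hull (s \<union> t) = s \<union> t"
proof (rule antisym)
  show "S hull (s \<union> t) \<subseteq> s \<union> t"
  proof
    fix a assume a: "a \<in> S hull (s \<union> t)"
    show "a \<in> s \<union> t"
    proof (rule ccontr)
      assume "a \<notin> s \<union> t"
      then have "a \<notin> S hull s" "a \<notin> S hull t" using assms(2,3) by simp_all
      then obtain u v where "S u" "s \<subseteq> u" "a \<notin> u" "S v" "t \<subseteq> v" "a \<notin> v"
        unfolding hull_def by blast
      then have "S (u \<union> v)" "s \<union> t \<subseteq> u \<union> v" "a \<notin> u \<union> v" using assms(1) by auto
      then show False using a unfolding hull_def by blast
    qed
  qed
qed (rule hull_subset)

section \<open>Coloops and single-element extensions\<close>

lemma coloop_iff_insert_indep:
  assumes "finite (indep N)" "\<And>Y Z. Z \<in> indep N \<Longrightarrow> Y \<subseteq> Z \<Longrightarrow> Y \<in> indep N"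
  shows "coloop N e \<longleftrightarrow> e \<in> ground N \<and> (\<forall>Z\<in>indep N. insert e Z \<in> indep N)"
proof -
  have "(\<forall>B. basis N B \<longrightarrow> e \<in> B) \<longleftrightarrow> (\<forall>Z\<in>indep N. insert e Z \<in> indep N)"
  proof (intro iffI ballI allI impI)
    fix Z assume coloop: "\<forall>B. basis N B \<longrightarrow> e \<in> B" and "Z \<in> indep N"
    from finite_has_maximal2[OF assms(1) this(2)]
    obtain B where B: "B \<in> indep N" "Z \<subseteq> B" "\<forall>W\<in>indep N. B \<subseteq> W \<longrightarrow> B = W"
      by (elim bexE conjE)
    then have "basis N B" by (auto simp: basis_def)
    then have "insert e Z \<subseteq> B" using coloop B(2) by blast
    then show "insert e Z \<in> indep N" using assms(2) B(1) by blast
  next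
    fix B assume "\<forall>Z\<in>indep N. insert e Z \<in> indep N" "basis N B"
    then have "insert e B = B" unfolding basis_def by blast
    then show "e \<in> B" by blast
  qed
  then show ?thesis by (simp add: coloop_def)
qed

definition single_element_extension :: "'a matroid \<Rightarrow> 'a \<Rightarrow> 'a matroid \<Rightarrow> bool" where
  "single_element_extension M x N \<longleftrightarrow> x \<notin> ground M \<and> ground N = insert x (ground M) \<and>
    (\<forall>W\<in>indep N. W \<subseteq> ground N) \<and> delete N {x} = M"

lemma single_element_extension_indep_iff:
  assumes "single_element_extension M x N" "x \<notin> W"
  shows "W \<in> indep N \<longleftrightarrow> W \<in> indep M"
proof -
  have "delete N {x} = M" "\<forall>W\<in>indep N. W \<subseteq> ground N"
    using assms(1) unfolding single_element_extension_def by blast+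
  then have "indep M = {I \<in> indep N. I \<subseteq> ground N - {x}}" "W \<in> indep N \<Longrightarrow> W \<subseteq> ground N"
    by (auto simp: delete_def)
  then show ?thesis using assms(2) by blast
qed

lemma single_element_extension_eq_iff:
  assumes "single_element_extension M x N" "single_element_extension M x N'"
  shows "N = N' \<longleftrightarrow> (\<forall>Z\<subseteq>ground M. insert x Z \<in> indep N \<longleftrightarrow> insert x Z \<in> indep N')"
proof
  assume iff: "\<forall>Z\<subseteq>ground M. insert x Z \<in> indep N \<longleftrightarrow> insert x Z \<in> indep N'"
  have indep_subset: "W - {x} \<subseteq> ground M" if "W \<in> indep N \<or> W \<in> indep N'" for W
    using that assms unfolding single_element_extension_def by blast
  have "W \<in> indep N \<longleftrightarrow> W \<in> indep N'" for W
  proof (cases "x \<in> W")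
    case True
    then have "insert x (W - {x}) = W" by blast
    then show ?thesis using iff indep_subset[of W] by metis
  next
    case False
    then show ?thesis using assms[THEN single_element_extension_indep_iff] by simp
  qed
  moreover have "ground N = ground N'"
    using assms by (simp add: single_element_extension_def)
  ultimately show "N = N'" by (intro matroid.expand) auto
qed simp

section \<open>Extensions of a presented matroid\<close>

text \<open>
  A name for the index set \<open>[r]\<close>, so that the equation expressing the rank through
  \<^const>\<open>matching_rank\<close> does not contain its own left-hand side.
\<close>

definition indices :: "'a matroid \<Rightarrow> nat set" where
  "indices M = {1..full_rank M}"

lemma finite_indices [simp]: "finite (indices M)"
  by (simp add: indices_def)

lemma card_indices: "card (indices M) = full_rank M"
  by (simp add: indices_def)

lemma supp_eq_hits: "supp M A X = hits A (indices M) X"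
  by (simp add: supp_def hits_def indices_def)

lemma supp_subset: "supp M A X \<subseteq> indices M"
  by (auto simp: supp_def indices_def)

lemma finite_supp: "finite (supp M A X)"
  by (simp add: supp_def)

lemma supp_mono: "X \<subseteq> Y \<Longrightarrow> supp M A X \<subseteq> supp M A Y"
  by (auto simp: supp_def)

lemma supp_Un: "supp M A (X \<union> Y) = supp M A X \<union> supp M A Y"
  by (auto simp: supp_def)

text \<open>Tightness for a single presentation is the case \<open>A = B\<close> of \<^const>\<open>tight\<close>.\<close>

lemma tight_self_iff: "tight M A A X \<longleftrightarrow> X \<subseteq> ground M \<and> card (supp M A X) = rank M X"
  unfolding tight_def by metis

locale presented_matroid =
  fixes M :: "'a matroid" and A :: "nat \<Rightarrow> 'a set" and x :: 'a
  assumes finite_ground: "finite (ground M)"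
    and presentation: "presentation M A"
    and new: "x \<notin> ground M"
begin

abbreviation "R \<equiv> indices M"
abbreviation "E \<equiv> ground M"
abbreviation "ext I \<equiv> ext_matroid M A x I"

lemma finite_subset_ground: "Z \<subseteq> E \<Longrightarrow> finite Z"
  using finite_ground finite_subset by blast

lemma sets_subset: "i \<in> R \<Longrightarrow> A i \<subseteq> E"
  using presentation by (simp add: presentation_def indices_def)

lemma indep_iff: "Z \<in> indep M \<longleftrightarrow> Z \<subseteq> E \<and> matchable A R Z"
proof -
  have "indep M = indep (transversal_matroid E (full_rank M) A)"
    using presentation unfolding presentation_def by (intro arg_cong[where f = indep]) blast
  then show ?thesis
    by (simp add: transversal_matroid_def partial_transversal_def matchable_def indices_def)
qed

lemma indep_subset: "Z \<in> indep M \<Longrightarrow> Y \<subseteq> Z \<Longrightarrow> Y \<in> indep M"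
  unfolding indep_iff using matchable_subset by blast

lemma rank_eq_matching_rank:
  assumes "X \<subseteq> E"
  shows "rank M X = matching_rank A R X"
proof -
  have "{card I | I. I \<subseteq> X \<and> I \<in> indep M} = {card Z | Z. Z \<subseteq> X \<and> matchable A R Z}"
    using assms by (auto simp: indep_iff)
  then show ?thesis
    using Max_card_matchable[OF finite_subset_ground[OF assms] finite_indices]
    by (simp add: rank_def)
qed

lemma indep_iff_rank:
  assumes "Z \<subseteq> E"
  shows "Z \<in> indep M \<longleftrightarrow> rank M Z = card Z"
  using assms matchable_iff_matching_rank[OF finite_subset_ground[OF assms], of R A]
  by (simp add: indep_iff rank_eq_matching_rank)

lemma rank_le_card: "Z \<subseteq> E \<Longrightarrow> rank M Z \<le> card Z"
  using matching_rank_le_card[OF finite_subset_ground] by (simp add: rank_eq_matching_rank)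

lemma rank_mono:
  assumes "Y \<subseteq> Z" "Z \<subseteq> E"
  shows "rank M Y \<le> rank M Z"
  using assms matching_rank_mono[of R Z Y A] finite_subset_ground[of Z]
  by (simp add: rank_eq_matching_rank)

lemma indep_basis:
  assumes "X \<subseteq> E"
  obtains Z where "Z \<subseteq> X" "Z \<in> indep M" "card Z = rank M X"
proof -
  obtain Z where "Z \<subseteq> X" "matchable A R Z" "card Z = matching_rank A R X"
    using matching_rank_basis[OF finite_subset_ground[OF assms] finite_indices] .
  then show thesis using that[of Z] assms by (simp add: indep_iff rank_eq_matching_rank)
qed

lemma subset_closure_iff:
  assumes "X \<subseteq> E" "Z \<subseteq> E"
  shows "X \<subseteq> closure M Z \<longleftrightarrow> rank M (Z \<union> X) = rank M Z"
proof
  assume "X \<subseteq> closure M Z"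
  then have "matching_rank A R (insert e Z) = matching_rank A R Z" if "e \<in> X" for e
    using that assms rank_eq_matching_rank[of "insert e Z"] rank_eq_matching_rank[of Z]
    by (auto simp: closure_def)
  then show "rank M (Z \<union> X) = rank M Z"
    using matching_rank_Un_eq[of X Z R A] assms
    by (simp add: finite_subset_ground rank_eq_matching_rank)
next
  assume eq: "rank M (Z \<union> X) = rank M Z"
  have "rank M (insert e Z) = rank M Z" if "e \<in> X" for e
  proof (rule antisym)
    show "rank M (insert e Z) \<le> rank M Z"
      using rank_mono[of "insert e Z" "Z \<union> X"] that eq assms by auto
    show "rank M Z \<le> rank M (insert e Z)"
      using that assms by (intro rank_mono) auto
  qed
  then show "X \<subseteq> closure M Z"
    using assms by (auto simp: closure_def)
qed

subsection \<open>Tight sets\<close>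

lemma tight_iff_saturating: "tight M A A X \<longleftrightarrow> X \<subseteq> E \<and> saturating A R X"
  using rank_eq_matching_rank[of X] by (auto simp: tight_self_iff saturating_def supp_eq_hits)

lemma tight_iff_if_indep:
  assumes "Y \<in> indep M"
  shows "tight M A A Y \<longleftrightarrow> critical A R Y"
proof -
  have "Y \<subseteq> E" using assms by (simp add: indep_iff)
  then show ?thesis
    using assms indep_iff_rank by (simp add: tight_self_iff critical_def supp_eq_hits)
qed

lemma tight_Un: "tight M A A X \<Longrightarrow> tight M A A Y \<Longrightarrow> tight M A A (X \<union> Y)"
  using saturating_Un[of Y X R A] by (simp add: tight_iff_saturating finite_subset_ground)

lemma rank_le_card_supp: "X \<subseteq> E \<Longrightarrow> rank M X \<le> card (supp M A X)"
  using matching_rank_le_card_hits[OF finite_subset_ground]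
  by (simp add: supp_eq_hits rank_eq_matching_rank)

lemma tight_ground: "tight M A A E" and supp_ground: "supp M A E = R"
proof -
  have "card R = rank M E" by (rule card_indices)
  also have "\<dots> \<le> card (supp M A E)" by (rule rank_le_card_supp) simp
  finally show "supp M A E = R"
    by (rule card_seteq[OF finite_indices supp_subset])
  then show "tight M A A E" by (simp add: tight_self_iff card_indices)
qed

lemma tight_basis:
  assumes "tight M A A X"
  obtains Y where "Y \<subseteq> X" "Y \<in> indep M" "tight M A A Y" "supp M A Y = supp M A X"
proof -
  have X: "X \<subseteq> E" "card (supp M A X) = rank M X" using assms by (auto simp: tight_self_iff)
  obtain Y where Y: "Y \<subseteq> X" "Y \<in> indep M" "card Y = rank M X"
    using indep_basis[OF X(1)] .
  have sub: "supp M A Y \<subseteq> supp M A X" using Y(1) by (rule supp_mono)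
  have "Y \<subseteq> E" using Y(1) X(1) by blast
  then have "card Y \<le> card (supp M A Y)"
    using rank_le_card_supp[of Y] indep_iff_rank[of Y] Y(2) by simp
  then have eq: "supp M A Y = supp M A X"
    using X(2) Y(3) by (intro card_seteq[OF finite_supp sub]) simp
  then have "tight M A A Y"
    using tight_iff_if_indep[OF Y(2)] X(2) Y(3) by (simp add: critical_def supp_eq_hits)
  then show thesis using that[OF Y(1,2) _ eq] by blast
qed

lemma supp_subset_if_subset_closure:
  assumes "tight M A A W" "Z \<subseteq> E" "Z \<subseteq> closure M W"
  shows "supp M A Z \<subseteq> supp M A W"
proof -
  have W: "W \<subseteq> E" "saturating A R W" using assms(1) by (auto simp: tight_iff_saturating)
  have "rank M (W \<union> Z) = rank M W"
    using subset_closure_iff[OF assms(2) W(1)] assms(3) by blast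
  then have "matching_rank A R (Z \<union> W) = matching_rank A R W"
    using W(1) assms(2) rank_eq_matching_rank[of "W \<union> Z"] rank_eq_matching_rank[of W]
    by (simp add: Un_commute)
  then show ?thesis
    using hits_subset_if_matching_rank_Un_eq[of W Z R A] W assms(2)
    by (simp add: supp_eq_hits finite_subset_ground)
qed

lemma rank_Un_tight:
  assumes "tight M A A X" "Z \<subseteq> E"
  shows "rank M (Z \<union> X) = matching_rank A (R - supp M A X) Z + card (supp M A X)"
proof -
  have "X \<subseteq> E" "saturating A R X" using assms(1) by (auto simp: tight_iff_saturating)
  then show ?thesis
    using matching_rank_contract[of X Z R A] assms(2)
    by (simp add: finite_subset_ground rank_eq_matching_rank supp_eq_hits)
qed

lemma matching_rank_ground: "D \<subseteq> R \<Longrightarrow> matching_rank A D E = card D"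
  using saturating_subset_indices[OF finite_ground finite_indices, of D M A]
    tight_ground hits_Int_indices[of A R D E] supp_ground
  by (simp add: tight_iff_saturating saturating_def supp_eq_hits Int_absorb1)

subsection \<open>The independent sets containing the new element\<close>

lemma indep_ext_iff:
  "W \<in> indep (ext I) \<longleftrightarrow> W \<subseteq> insert x E \<and> matchable (extend_system A x I) R W"
  by (simp add: ext_matroid_def transversal_matroid_def partial_transversal_def matchable_def
      indices_def)

lemma matchable_extend_system_iff:
  assumes "Z \<subseteq> E"
  shows "matchable (extend_system A x I) C Z \<longleftrightarrow> matchable A C Z"
  using assms new by (intro matchable_cong) (auto simp: extend_system_def)

lemma ground_ext: "ground (ext I) = insert x E"
  by (simp add: ext_matroid_def transversal_matroid_def)

lemma single_element_extension_ext: "single_element_extension M x (ext I)"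
proof -
  have "delete (ext I) {x} = M"
  proof (rule matroid.expand, intro conjI)
    show "ground (delete (ext I) {x}) = ground M"
      using new by (simp add: delete_def ground_ext)
    show "indep (delete (ext I) {x}) = indep M"
      using new
      by (auto simp: delete_def ground_ext indep_ext_iff indep_iff matchable_extend_system_iff)
  qed
  then show ?thesis
    using new indep_ext_iff by (auto simp: single_element_extension_def ground_ext)
qed

lemmas indep_ext_old_iff = single_element_extension_indep_iff[OF single_element_extension_ext]

lemma insert_new_indep_ext_iff:
  assumes "Z \<subseteq> E" "I \<subseteq> R"
  shows "insert x Z \<in> indep (ext I) \<longleftrightarrow> (\<exists>i\<in>I. matchable A (R - {i}) Z)"
proof -
  have "x \<in> extend_system A x I i \<longleftrightarrow> i \<in> I" if "i \<in> R" for i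
    using that sets_subset new by (auto simp: extend_system_def)
  moreover have "x \<notin> Z" "insert x Z \<subseteq> insert x E" using assms(1) new by auto
  ultimately show ?thesis
    using matchable_insert_iff[OF \<open>x \<notin> Z\<close>, of "extend_system A x I" R] assms(2)
      matchable_extend_system_iff[OF assms(1)] by (auto simp: indep_ext_iff)
qed

lemma indep_if_insert_new_indep_ext:
  assumes "Z \<subseteq> E" "I \<subseteq> R" "insert x Z \<in> indep (ext I)"
  shows "Z \<in> indep M"
proof -
  obtain i where "matchable A (R - {i}) Z"
    using assms(3) unfolding insert_new_indep_ext_iff[OF assms(1,2)] by blast
  then have "matchable A R Z" by (rule matchable_mono_indices) blast
  then show ?thesis using assms(1) by (simp add: indep_iff)
qed

lemma insert_new_dependent_iff_tight:
  assumes "Z \<in> indep M" "I \<subseteq> R"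
  shows "insert x Z \<notin> indep (ext I) \<longleftrightarrow> (\<exists>Y\<subseteq>Z. tight M A A Y \<and> I \<subseteq> supp M A Y)"
proof -
  have Z: "Z \<subseteq> E" "matchable A R Z" using assms(1) by (auto simp: indep_iff)
  have "tight M A A Y \<longleftrightarrow> critical A R Y" if "Y \<subseteq> Z" for Y
    using tight_iff_if_indep indep_subset[OF assms(1) that] .
  then show ?thesis
    using unavoidable_iff_critical_cover[OF finite_subset_ground[OF Z(1)] finite_indices Z(2)]
    unfolding insert_new_indep_ext_iff[OF Z(1) assms(2)] supp_eq_hits by (metis (no_types))
qed

lemma insert_new_dependent_iff_supp:
  assumes "Y \<in> indep M" "tight M A A Y" "I \<subseteq> R"
  shows "insert x Y \<notin> indep (ext I) \<longleftrightarrow> I \<subseteq> supp M A Y"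
  using insert_new_dependent_iff_tight[OF assms(1,3)] assms(2) supp_mono[of _ Y M A] by blast

lemma insert_new_indep_ext_iff_matching_rank:
  assumes "Z \<in> indep M" "I \<subseteq> R"
  shows "insert x Z \<in> indep (ext I) \<longleftrightarrow> card Z < matching_rank A (R - I) Z + card I"
proof -
  have Z: "Z \<subseteq> E" "matchable A R Z" using assms(1) by (auto simp: indep_iff)
  have "insert x Z \<in> indep (ext I) \<longleftrightarrow> \<not> (\<exists>Y\<subseteq>Z. critical A R Y \<and> I \<subseteq> hits A R Y)"
    unfolding insert_new_indep_ext_iff[OF Z(1) assms(2)]
    using unavoidable_iff_critical_cover[OF finite_subset_ground[OF Z(1)] finite_indices Z(2), of I]
    by blast
  also have "\<dots> \<longleftrightarrow> \<not> matching_rank A (R - I) Z + card I \<le> card Z"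
    using critical_cover_iff_matching_rank[OF finite_subset_ground[OF Z(1)] finite_indices assms(2)]
      hall_condition_if_matchable[OF finite_indices Z(2)] by simp
  finally show ?thesis by (simp add: not_le)
qed

lemma minimal_dependent_tight:
  assumes "Y \<in> indep M" "I \<subseteq> R" "insert x Y \<notin> indep (ext I)"
    and "\<And>V. V \<subset> Y \<Longrightarrow> insert x V \<in> indep (ext I)"
  shows "tight M A A Y" "I \<subseteq> supp M A Y"
proof -
  obtain V where V: "V \<subseteq> Y" "tight M A A V" "I \<subseteq> supp M A V"
    using insert_new_dependent_iff_tight[OF assms(1,2)] assms(3) by blast
  then have "insert x V \<notin> indep (ext I)"
    using insert_new_dependent_iff_supp indep_subset[OF assms(1)] assms(2) by blast
  then have "V = Y" using assms(4)[of V] V(1) by blast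
  then show "tight M A A Y" "I \<subseteq> supp M A Y" using V by auto
qed

subsection \<open>The closure operator on index sets\<close>

lemma indep_delete_ext_iff: "W \<in> indep (delete (ext I) D) \<longleftrightarrow> W \<in> indep (ext I) \<and> W \<inter> D = {}"
  by (auto simp: delete_def ground_ext indep_ext_iff)

lemma coloop_delete_ext_iff_insert_indep:
  assumes "k \<in> R"
  shows "coloop (delete (ext I) (A k)) x
    \<longleftrightarrow> (\<forall>Z\<in>indep M. k \<notin> supp M A Z \<longrightarrow> insert x Z \<in> indep (ext I))"
proof -
  let ?D = "delete (ext I) (A k)"
  have x: "x \<notin> A k" using sets_subset[OF assms] new by blast
  have disjoint_iff: "Z \<inter> A k = {} \<longleftrightarrow> k \<notin> supp M A Z" for Z
    using assms by (simp add: supp_def indices_def)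
  have "indep ?D \<subseteq> Pow (insert x E)" by (auto simp: indep_delete_ext_iff indep_ext_iff)
  then have "finite (indep ?D)" by (rule finite_subset) (simp add: finite_ground)
  moreover have "Y \<in> indep ?D" if "Z \<in> indep ?D" "Y \<subseteq> Z" for Y Z
    using that matchable_subset[of _ R Z Y] by (auto simp: indep_delete_ext_iff indep_ext_iff)
  ultimately have "coloop ?D x \<longleftrightarrow> x \<in> ground ?D \<and> (\<forall>Z\<in>indep ?D. insert x Z \<in> indep ?D)"
    by (rule coloop_iff_insert_indep)
  also have "\<dots> \<longleftrightarrow> (\<forall>Z\<in>indep ?D. insert x Z \<in> indep (ext I))"
    using x by (auto simp: indep_delete_ext_iff delete_def ground_ext)
  also have "\<dots> \<longleftrightarrow> (\<forall>Z\<in>indep M. Z \<inter> A k = {} \<longrightarrow> insert x Z \<in> indep (ext I))"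
  proof (intro iffI ballI impI)
    fix Z assume "\<forall>Z\<in>indep ?D. insert x Z \<in> indep (ext I)" "Z \<in> indep M" "Z \<inter> A k = {}"
    moreover have "x \<notin> Z" using \<open>Z \<in> indep M\<close> new by (auto simp: indep_iff)
    ultimately show "insert x Z \<in> indep (ext I)"
      using indep_ext_old_iff by (simp add: indep_delete_ext_iff)
  next
    fix Z assume "\<forall>Z\<in>indep M. Z \<inter> A k = {} \<longrightarrow> insert x Z \<in> indep (ext I)" "Z \<in> indep ?D"
    then show "insert x Z \<in> indep (ext I)"
      using indep_ext_old_iff[of Z]
      by (cases "x \<in> Z") (simp_all add: indep_delete_ext_iff insert_absorb)
  qed
  finally show ?thesis unfolding disjoint_iff .
qed

lemma coloop_delete_ext_iff:
  assumes "I \<subseteq> R" "k \<in> R"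
  shows "coloop (delete (ext I) (A k)) x
    \<longleftrightarrow> (\<forall>X. tight M A A X \<and> I \<subseteq> supp M A X \<longrightarrow> k \<in> supp M A X)"
  unfolding coloop_delete_ext_iff_insert_indep[OF assms(2)]
proof (intro iffI allI ballI impI)
  fix X
  assume insert_indep: "\<forall>Z\<in>indep M. k \<notin> supp M A Z \<longrightarrow> insert x Z \<in> indep (ext I)"
    and X: "tight M A A X \<and> I \<subseteq> supp M A X"
  from tight_basis[OF conjunct1[OF X]]
  obtain Y where Y: "Y \<in> indep M" "tight M A A Y" "supp M A Y = supp M A X" .
  then have "insert x Y \<notin> indep (ext I)"
    using insert_new_dependent_iff_supp[OF Y(1,2) assms(1)] X by simp
  then show "k \<in> supp M A X" using insert_indep Y(1,3) by blast
next
  fix Z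
  assume "\<forall>X. tight M A A X \<and> I \<subseteq> supp M A X \<longrightarrow> k \<in> supp M A X"
    and "Z \<in> indep M" "k \<notin> supp M A Z"
  then have "\<not> (\<exists>Y\<subseteq>Z. tight M A A Y \<and> I \<subseteq> supp M A Y)"
    using supp_mono[of _ Z M A] by blast
  then show "insert x Z \<in> indep (ext I)"
    using insert_new_dependent_iff_tight[OF \<open>Z \<in> indep M\<close> assms(1)] by blast
qed

lemma sigma_eq_hull:
  assumes "I \<subseteq> R"
  shows "sigma M A x I = star M A A hull I"
proof (rule set_eqI)
  fix k
  have mem_hull_iff: "k \<in> star M A A hull I
      \<longleftrightarrow> (\<forall>X. tight M A A X \<and> I \<subseteq> supp M A X \<longrightarrow> k \<in> supp M A X)"
    unfolding hull_def star_def by blast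
  have mem_sigma_iff: "k \<in> sigma M A x I \<longleftrightarrow> k \<in> I \<or> k \<in> R \<and> coloop (delete (ext I) (A k)) x"
    unfolding sigma_def indices_def by blast
  show "k \<in> sigma M A x I \<longleftrightarrow> k \<in> star M A A hull I"
  proof (cases "k \<in> R")
    case True
    then show ?thesis
      using coloop_delete_ext_iff[OF assms True] unfolding mem_sigma_iff mem_hull_iff by blast
  next
    case False
    then show ?thesis
      using assms tight_ground supp_ground unfolding mem_sigma_iff mem_hull_iff by blast
  qed
qed

lemma L_sets_iff: "I \<in> L_sets M A x \<longleftrightarrow> I \<subseteq> R \<and> star M A A hull I = I"
  unfolding L_sets_def mem_Collect_eq indices_def[symmetric] by (metis sigma_eq_hull)

lemma star_hull_separate:
  assumes "star M A A hull I = I" "k \<notin> I"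
  obtains Y where "Y \<in> indep M" "tight M A A Y" "I \<subseteq> supp M A Y" "k \<notin> supp M A Y"
proof -
  obtain X where X: "tight M A A X" "I \<subseteq> supp M A X" "k \<notin> supp M A X"
    using assms unfolding hull_def star_def by blast
  obtain Y where "Y \<in> indep M" "tight M A A Y" "supp M A Y = supp M A X"
    using tight_basis[OF X(1)] .
  then show thesis using that[of Y] X by simp
qed

lemma L_sets_Inter:
  assumes "F \<noteq> {}" "F \<subseteq> L_sets M A x"
  shows "\<Inter>F \<in> L_sets M A x"
proof -
  have "\<Inter>F \<subseteq> R" using assms L_sets_iff by blast
  moreover have "star M A A hull \<Inter>F = \<Inter>F"
    using assms(2) L_sets_iff by (intro hull_Inter_fixed) blast
  ultimately show ?thesis by (simp add: L_sets_iff)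
qed

lemma star_self_Un: "star M A A I \<Longrightarrow> star M A A J \<Longrightarrow> star M A A (I \<union> J)"
  unfolding star_def using tight_Un supp_Un by metis

lemma L_sets_Un: "I \<in> L_sets M A x \<Longrightarrow> J \<in> L_sets M A x \<Longrightarrow> I \<union> J \<in> L_sets M A x"
  unfolding L_sets_iff using hull_Un_fixed[of "star M A A" I J, OF star_self_Un] by blast

lemma supp_in_L_sets: "tight M A A X \<Longrightarrow> supp M A X \<in> L_sets M A x"
  unfolding L_sets_iff using supp_subset by (auto intro!: hull_same simp: star_def)

lemma ext_eq_imp_subset:
  assumes "I \<in> L_sets M A x" "J \<in> L_sets M A x" "ext I = ext J"
  shows "I \<subseteq> J"
proof
  fix k assume "k \<in> I"
  show "k \<in> J"
  proof (rule ccontr)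
    assume "k \<notin> J"
    obtain Y where Y: "Y \<in> indep M" "tight M A A Y" "J \<subseteq> supp M A Y" "k \<notin> supp M A Y"
      using star_hull_separate[OF _ \<open>k \<notin> J\<close>] assms(2) L_sets_iff by blast
    have "I \<subseteq> supp M A Y"
      using insert_new_dependent_iff_supp[OF Y(1,2)] Y(3) assms L_sets_iff by metis
    then show False using \<open>k \<in> I\<close> Y(4) by blast
  qed
qed

lemma inj_on_ext: "inj_on (ext_matroid M A x) (L_sets M A x)"
  by (intro inj_onI antisym ext_eq_imp_subset) simp_all

lemma insert_new_indep_ext_Un_iff:
  assumes "Z \<subseteq> E" "I \<subseteq> R" "J \<subseteq> R"
  shows "insert x Z \<in> indep (ext (I \<union> J))
    \<longleftrightarrow> insert x Z \<in> indep (ext I) \<or> insert x Z \<in> indep (ext J)"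
  using assms by (simp add: insert_new_indep_ext_iff bex_Un)

subsection \<open>Principal extensions\<close>

lemma single_element_extension_principal:
  "single_element_extension M x (principal_extension M X x)"
proof -
  let ?P = "principal_extension M X x"
  have ground: "ground ?P = insert x E" by (simp add: principal_extension_def)
  have "W \<in> indep ?P \<longleftrightarrow> W \<in> indep M" if "W \<subseteq> E" for W
    using that new indep_iff_rank[OF that]
    by (auto simp: principal_extension_def principal_ext_rank_def)
  moreover have "W \<in> indep M \<Longrightarrow> W \<subseteq> E" for W by (simp add: indep_iff)
  ultimately have "{W \<in> indep ?P. W \<subseteq> E} = indep M" by blast
  moreover have "insert x E - {x} = E" using new by blast
  ultimately have "delete ?P {x} = M"
    by (simp add: delete_def ground)
  moreover have "\<forall>W\<in>indep ?P. W \<subseteq> ground ?P"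
    by (simp add: principal_extension_def)
  ultimately show ?thesis
    using new ground by (simp add: single_element_extension_def)
qed

lemma insert_new_indep_principal_iff:
  assumes "Z \<subseteq> E"
  shows "insert x Z \<in> indep (principal_extension M X x) \<longleftrightarrow> Z \<in> indep M \<and> \<not> X \<subseteq> closure M Z"
proof -
  have "x \<notin> Z" using assms new by blast
  then have "insert x Z - {x} = Z" "card (insert x Z) = Suc (card Z)" "insert x Z \<subseteq> insert x E"
    using assms finite_subset_ground by auto
  then show ?thesis
    using indep_iff_rank[OF assms] rank_le_card[OF assms]
    by (simp add: principal_extension_def principal_ext_rank_def)
qed

lemma ext_supp_eq_principal:
  assumes "tight M A A X"
  shows "ext (supp M A X) = principal_extension M X x"
  unfolding single_element_extension_eq_iff[OF single_element_extension_ext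
      single_element_extension_principal]
proof (intro allI impI)
  fix Z assume Z: "Z \<subseteq> E"
  have X: "X \<subseteq> E" using assms by (simp add: tight_self_iff)
  show "insert x Z \<in> indep (ext (supp M A X)) \<longleftrightarrow> insert x Z \<in> indep (principal_extension M X x)"
  proof (cases "Z \<in> indep M")
    case True
    have "insert x Z \<in> indep (ext (supp M A X)) \<longleftrightarrow> rank M Z < rank M (Z \<union> X)"
      using insert_new_indep_ext_iff_matching_rank[OF True supp_subset] rank_Un_tight[OF assms Z]
        True indep_iff_rank[OF Z] by simp
    also have "\<dots> \<longleftrightarrow> \<not> X \<subseteq> closure M Z"
      using subset_closure_iff[OF X Z] rank_mono[of Z "Z \<union> X"] Z X by auto
    finally show ?thesis
      using True insert_new_indep_principal_iff[OF Z] by simp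
  next
    case False
    then show ?thesis
      using indep_if_insert_new_indep_ext[OF Z supp_subset] insert_new_indep_principal_iff[OF Z]
      by blast
  qed
qed

end

section \<open>Common extensions of two presentations\<close>

locale two_presentations =
  A: presented_matroid M A x + B: presented_matroid M B x
  for M :: "'a matroid" and A B :: "nat \<Rightarrow> 'a set" and x :: 'a
begin

abbreviation "R \<equiv> indices M"
abbreviation "E \<equiv> ground M"

lemma tight_iff: "tight M A B X \<longleftrightarrow> tight M A A X \<and> tight M B B X"
  unfolding tight_def by metis

lemma tight_ground: "tight M A B E"
  using A.tight_ground B.tight_ground by (simp add: tight_iff)

lemma ext_eq_iff:
  "A.ext I = B.ext J
    \<longleftrightarrow> (\<forall>Z\<subseteq>E. insert x Z \<in> indep (A.ext I) \<longleftrightarrow> insert x Z \<in> indep (B.ext J))"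
  using A.single_element_extension_ext B.single_element_extension_ext
  by (rule single_element_extension_eq_iff)

lemma ext_eq_if_equirank:
  assumes "I \<subseteq> R" "J \<subseteq> R" "equirank E A (R - I) B (R - J)"
  shows "A.ext I = B.ext J"
proof -
  have "card (R - I) = card (R - J)"
    using assms(3) A.matching_rank_ground[of "R - I"] B.matching_rank_ground[of "R - J"]
    by (simp add: equirank_def)
  then have "card I = card J"
    using card_subset_add_card_Diff[OF finite_indices assms(1)]
      card_subset_add_card_Diff[OF finite_indices assms(2)] by simp
  then have "insert x Z \<in> indep (A.ext I) \<longleftrightarrow> insert x Z \<in> indep (B.ext J)"
    if "Z \<subseteq> E" "Z \<in> indep M" for Z
    using A.insert_new_indep_ext_iff_matching_rank[OF that(2) assms(1)]
      B.insert_new_indep_ext_iff_matching_rank[OF that(2) assms(2)] assms(3) that(1)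
    by (simp add: equirank_def)
  then show ?thesis
    unfolding ext_eq_iff
    using A.indep_if_insert_new_indep_ext[OF _ assms(1)]
      B.indep_if_insert_new_indep_ext[OF _ assms(2)] by blast
qed

lemma ext_INT_supp_eq:
  assumes "\<X> \<noteq> {}" "\<And>X. X \<in> \<X> \<Longrightarrow> tight M A B X"
  shows "A.ext (\<Inter>X\<in>\<X>. supp M A X) = B.ext (\<Inter>X\<in>\<X>. supp M B X)"
proof (rule ext_eq_if_equirank)
  have tight: "X \<subseteq> E \<and> saturating A R X \<and> saturating B R X" if "X \<in> \<X>" for X
    using assms(2)[OF that]
    by (simp add: tight_iff A.tight_iff_saturating B.tight_iff_saturating)
  then have "\<X> \<subseteq> Pow E" by blast
  then have "finite \<X>" by (rule finite_subset) (simp add: A.finite_ground)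
  moreover have "equirank E A R B R"
    using A.rank_eq_matching_rank B.rank_eq_matching_rank by (simp add: equirank_def)
  ultimately show "equirank E A (R - (\<Inter>X\<in>\<X>. supp M A X)) B (R - (\<Inter>X\<in>\<X>. supp M B X))"
    unfolding supp_eq_hits using assms(1) tight
    by (intro equirank_Diff_INT_hits) (simp_all add: A.finite_ground)
qed (use assms(1) supp_subset in blast)+

lemma common_dependent_tight:
  assumes "I \<subseteq> R" "J \<subseteq> R" "A.ext I = B.ext J" "W \<in> indep M" "insert x W \<notin> indep (A.ext I)"
  obtains Y where "Y \<subseteq> W" "tight M A B Y" "I \<subseteq> supp M A Y"
proof -
  let ?F = "{Y. Y \<subseteq> W \<and> insert x Y \<notin> indep (A.ext I)}"
  have "finite W" using assms(4) A.finite_subset_ground by (simp add: A.indep_iff)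
  then have "finite ?F" "W \<in> ?F" using assms(5) by auto
  from finite_has_minimal2[OF this]
  obtain Y where Y: "Y \<in> ?F" and "\<forall>V\<in>?F. V \<subseteq> Y \<longrightarrow> Y = V" by (elim bexE conjE)
  then have below: "insert x V \<in> indep (A.ext I)" if "V \<subset> Y" for V
    using that by auto
  have ind: "Y \<in> indep M" using A.indep_subset[OF assms(4)] Y by blast
  have dep: "insert x Y \<notin> indep (A.ext I)" using Y by blast
  have "tight M A B Y"
    using A.minimal_dependent_tight(1)[OF ind assms(1) dep below]
      B.minimal_dependent_tight(1)[OF ind assms(2)] dep below unfolding tight_iff assms(3) by blast
  then show thesis
    using that[of Y] A.minimal_dependent_tight(2)[OF ind assms(1) dep below] Y by blast
qed

lemma L_common_hull_fixed:
  assumes "I \<in> L_common M A B x"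
  shows "star M A B hull I = I"
proof (rule antisym)
  obtain J where "J \<in> L_sets M B x" and eq: "A.ext I = B.ext J"
    using assms by (auto simp: L_common_def)
  then have J: "J \<subseteq> R" by (simp add: B.L_sets_iff)
  have I: "I \<subseteq> R" "star M A A hull I = I"
    using assms by (auto simp: L_common_def A.L_sets_iff)
  show "star M A B hull I \<subseteq> I"
  proof
    fix k assume k: "k \<in> star M A B hull I"
    show "k \<in> I"
    proof (rule ccontr)
      assume "k \<notin> I"
      obtain W where W: "W \<in> indep M" "tight M A A W" "I \<subseteq> supp M A W" "k \<notin> supp M A W"
        using A.star_hull_separate[OF I(2) \<open>k \<notin> I\<close>] .
      then have "insert x W \<notin> indep (A.ext I)"
        using A.insert_new_dependent_iff_supp[OF W(1,2) I(1)] by blast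
      then obtain Y where Y: "Y \<subseteq> W" "tight M A B Y" "I \<subseteq> supp M A Y"
        using common_dependent_tight[OF I(1) J eq W(1)] by blast
      then have "k \<in> supp M A Y"
        using k unfolding hull_def star_def by blast
      then show False using supp_mono[OF Y(1)] W(4) by blast
    qed
  qed
qed (rule hull_subset)

lemma star_in_L_sets: "star M A B I \<Longrightarrow> I \<in> L_sets M A x"
  using A.supp_in_L_sets by (auto simp: star_def tight_iff)

lemma Inter_star_in_L_common:
  assumes "F \<noteq> {}" "\<And>I. I \<in> F \<Longrightarrow> star M A B I"
  shows "\<Inter>F \<in> L_common M A B x"
proof -
  define \<X> where "\<X> = {X. tight M A B X \<and> supp M A X \<in> F}"
  have F: "F = supp M A ` \<X>" using assms(2) by (auto simp: \<X>_def star_def)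
  then have ne: "\<X> \<noteq> {}" using assms(1) by blast
  have "A.ext (\<Inter>F) = B.ext (\<Inter>X\<in>\<X>. supp M B X)"
    unfolding F using ne by (rule ext_INT_supp_eq) (simp add: \<X>_def)
  moreover have "\<Inter>F \<in> L_sets M A x"
    using assms star_in_L_sets by (intro A.L_sets_Inter subsetI) simp_all
  moreover have "(\<Inter>X\<in>\<X>. supp M B X) \<in> L_sets M B x"
    using ne B.supp_in_L_sets unfolding \<X>_def tight_iff by (intro B.L_sets_Inter) blast+
  ultimately show ?thesis by (auto simp: L_common_def)
qed

lemma L_common_eq:
  "L_common M A B x = {\<Inter>F | F. F \<noteq> {} \<and> F \<subseteq> {I \<in> L_sets M A x. star M A B I}}"
proof (intro equalityI subsetI)
  fix I assume I: "I \<in> L_common M A B x"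
  let ?F = "{S. star M A B S \<and> I \<subseteq> S}"
  have "I = \<Inter>?F" using L_common_hull_fixed[OF I] by (simp add: hull_def)
  moreover have "I \<subseteq> supp M A E"
    using I by (simp add: L_common_def A.L_sets_iff A.supp_ground)
  then have "supp M A E \<in> ?F" using tight_ground by (auto simp: star_def)
  then have "?F \<noteq> {}" by blast
  moreover have "?F \<subseteq> {I \<in> L_sets M A x. star M A B I}" using star_in_L_sets by blast
  ultimately show "I \<in> {\<Inter>F | F. F \<noteq> {} \<and> F \<subseteq> {I \<in> L_sets M A x. star M A B I}}" by blast
next
  fix I assume "I \<in> {\<Inter>F | F. F \<noteq> {} \<and> F \<subseteq> {I \<in> L_sets M A x. star M A B I}}"
  then show "I \<in> L_common M A B x" using Inter_star_in_L_common by blast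
qed

lemma L_common_Int:
  assumes "I \<in> L_common M A B x" "J \<in> L_common M A B x"
  shows "I \<inter> J \<in> L_common M A B x"
proof -
  obtain F G where "I = \<Inter>F" "F \<noteq> {}" "F \<subseteq> {I \<in> L_sets M A x. star M A B I}"
      "J = \<Inter>G" "G \<noteq> {}" "G \<subseteq> {I \<in> L_sets M A x. star M A B I}"
    using assms unfolding L_common_eq by blast
  then show ?thesis using Inter_star_in_L_common[of "F \<union> G"] by (auto simp: Inter_Un_distrib)
qed

lemma L_common_Un:
  assumes "I1 \<in> L_common M A B x" "I2 \<in> L_common M A B x"
  shows "I1 \<union> I2 \<in> L_common M A B x"
proof -
  obtain J1 J2 where J: "J1 \<in> L_sets M B x" "A.ext I1 = B.ext J1"
      "J2 \<in> L_sets M B x" "A.ext I2 = B.ext J2"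
    using assms by (auto simp: L_common_def)
  have I: "I1 \<in> L_sets M A x" "I2 \<in> L_sets M A x"
    using assms by (auto simp: L_common_def)
  have "A.ext (I1 \<union> I2) = B.ext (J1 \<union> J2)"
    using I J A.insert_new_indep_ext_Un_iff[of _ I1 I2] B.insert_new_indep_ext_Un_iff[of _ J1 J2]
    unfolding A.L_sets_iff B.L_sets_iff ext_eq_iff by metis
  then show ?thesis
    using A.L_sets_Un[OF I] B.L_sets_Un[OF J(1,3)] by (auto simp: L_common_def)
qed

lemma tight_ext_eq_principal:
  assumes "tight M A B X"
  shows "A.ext (supp M A X) = principal_extension M X x"
    "B.ext (supp M B X) = principal_extension M X x"
  using assms A.ext_supp_eq_principal B.ext_supp_eq_principal by (simp_all add: tight_iff)

lemma tight_principal_in_T_exts: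
  assumes "tight M A B X"
  shows "principal_extension M X x \<in> T_exts M A x \<inter> T_exts M B x"
proof
  have "A.ext (supp M A X) \<in> T_exts M A x" "B.ext (supp M B X) \<in> T_exts M B x"
    using assms A.supp_in_L_sets B.supp_in_L_sets unfolding T_exts_def tight_iff by blast+
  then show "principal_extension M X x \<in> T_exts M A x" "principal_extension M X x \<in> T_exts M B x"
    by (simp_all add: tight_ext_eq_principal[OF assms])
qed

lemma star_if_principal:
  assumes "I \<in> L_sets M A x" "J \<in> L_sets M B x" "A.ext I = B.ext J"
    and "Y \<subseteq> E" "A.ext I = principal_extension M Y x"
  shows "star M A B I"
proof -
  have I: "I \<subseteq> R" "star M A A hull I = I" and J: "J \<subseteq> R"
    using assms(1,2) by (simp_all add: A.L_sets_iff B.L_sets_iff)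
  have dependent_iff: "insert x Z \<notin> indep (A.ext I) \<longleftrightarrow> Y \<subseteq> closure M Z" if "Z \<in> indep M" for Z
    using A.insert_new_indep_principal_iff[of Z Y] that assms(5) by (simp add: A.indep_iff)
  obtain W where W: "W \<subseteq> Y" "W \<in> indep M" "card W = rank M Y"
    using A.indep_basis[OF assms(4)] .
  have "W \<subseteq> E" using W(1) assms(4) by blast
  then have "Y \<subseteq> closure M W"
    using A.subset_closure_iff[OF assms(4)] A.indep_iff_rank W by (simp add: Un_absorb1)
  then obtain X where X: "X \<subseteq> W" "tight M A B X" "I \<subseteq> supp M A X"
    using common_dependent_tight[OF I(1) J assms(3) W(2)] dependent_iff[OF W(2)] by blast
  have "supp M A X \<subseteq> I"
  proof
    fix k assume k: "k \<in> supp M A X"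
    show "k \<in> I"
    proof (rule ccontr)
      assume "k \<notin> I"
      obtain V where V: "V \<in> indep M" "tight M A A V" "I \<subseteq> supp M A V" "k \<notin> supp M A V"
        using A.star_hull_separate[OF I(2) \<open>k \<notin> I\<close>] .
      have "Y \<subseteq> closure M V"
        using dependent_iff[OF V(1)] A.insert_new_dependent_iff_supp[OF V(1,2) I(1)] V(3) by blast
      then have "X \<subseteq> E" "X \<subseteq> closure M V" using X(1) W(1) \<open>W \<subseteq> E\<close> by auto
      then have "supp M A X \<subseteq> supp M A V" by (rule A.supp_subset_if_subset_closure[OF V(2)])
      then show False using k V(4) by blast
    qed
  qed
  then show ?thesis using X(2,3) by (auto simp: star_def)
qed

lemma bij_betw_star_principal:
  "bij_betw (ext_matroid M A x) {I \<in> L_sets M A x. star M A B I}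
    {N \<in> T_exts M A x \<inter> T_exts M B x. \<exists>Y\<subseteq>E. N = principal_extension M Y x}"
proof (rule bij_betw_imageI)
  show "inj_on (ext_matroid M A x) {I \<in> L_sets M A x. star M A B I}"
    by (rule inj_on_subset[OF A.inj_on_ext]) blast
  show "ext_matroid M A x ` {I \<in> L_sets M A x. star M A B I}
      = {N \<in> T_exts M A x \<inter> T_exts M B x. \<exists>Y\<subseteq>E. N = principal_extension M Y x}"
  proof (intro equalityI subsetI)
    fix N assume "N \<in> ext_matroid M A x ` {I \<in> L_sets M A x. star M A B I}"
    then obtain X where X: "tight M A B X" "N = A.ext (supp M A X)"
      by (auto simp: star_def)
    then have "X \<subseteq> E" "N = principal_extension M X x"
      using tight_ext_eq_principal(1) by (simp_all add: tight_def)
    then show "N \<in> {N \<in> T_exts M A x \<inter> T_exts M B x. \<exists>Y\<subseteq>E. N = principal_extension M Y x}"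
      using tight_principal_in_T_exts[OF X(1)] by blast
  next
    fix N
    assume "N \<in> {N \<in> T_exts M A x \<inter> T_exts M B x. \<exists>Y\<subseteq>E. N = principal_extension M Y x}"
    then obtain I J Y where "I \<in> L_sets M A x" "J \<in> L_sets M B x" "N = A.ext I"
        "N = B.ext J" "Y \<subseteq> E" "N = principal_extension M Y x"
      unfolding T_exts_def by blast
    then show "N \<in> ext_matroid M A x ` {I \<in> L_sets M A x. star M A B I}"
      using star_if_principal[of I J Y] by blast
  qed
qed

end

theorem theorem3p16:
  fixes M :: "'a matroid" and A B :: "nat \<Rightarrow> 'a set" and x :: 'a
  assumes "finite (ground M)"
    and "presentation M A" and "presentation M B"
    and "x \<notin> ground M"
  shows "L_common M A B x \<subseteq> L_sets M A x \<and>
    (\<forall>I \<in> L_common M A B x. \<forall>J \<in> L_common M A B x.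
       I \<inter> J \<in> L_common M A B x \<and> I \<union> J \<in> L_common M A B x) \<and>
    L_common M A B x =
      {\<Inter>F | F. F \<noteq> {} \<and> F \<subseteq> {I \<in> L_sets M A x. star M A B I}} \<and>
    (\<forall>X. tight M A B X \<longrightarrow>
       ext_matroid M A x (supp M A X) = principal_extension M X x \<and>
       ext_matroid M B x (supp M B X) = principal_extension M X x \<and>
       principal_extension M X x \<in> T_exts M A x \<inter> T_exts M B x) \<and>
    bij_betw (ext_matroid M A x) {I \<in> L_sets M A x. star M A B I}
      {N \<in> T_exts M A x \<inter> T_exts M B x. \<exists>Y \<subseteq> ground M. N = principal_extension M Y x}"
proof -
  interpret two_presentations M A B x
    using assms by unfold_locales
  have "L_common M A B x \<subseteq> L_sets M A x" by (auto simp: L_common_def)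
  then show ?thesis
    by (intro conjI ballI allI impI L_common_Int L_common_Un L_common_eq bij_betw_star_principal
        tight_ext_eq_principal tight_principal_in_T_exts)
qed

end
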